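(* Let $H$ be a graph. Then the class of $H$-free graphs is $(\mathrm{tw},\omega)$-bounded if and only if one of the following conditions holds. (1) $H$ is an induced subgraph of $P_3$, in which case $f(k)=k-1$ is a $(\mathrm{tw},\omega)$-binding function for the class. (2) $H$ is edgeless, in which case $f(k)=R(k+1,|V(H)|)-2$ is a $(\mathrm{tw},\omega)$-binding function for the class.
   Context: All graphs are finite, simple, undirected and have at least one vertex. $\mathrm{tw}(G)$ is the treewidth and $\omega(G)$ the clique number (maximum size of a clique) of $G$. A graph class $\mathcal{G}$ is $(\mathrm{tw},\omega)$-bounded if there is a function $f:\mathbb{N}\to\mathbb{N}$ such that for every $G\in\mathcal{G}$ and every induced subgraph $G'$ of $G$, $\mathrm{tw}(G')\le f(\omega(G'))$; such an $f$ is a $(\mathrm{tw},\omega)$-binding function for $\mathcal{G}$. Explicit formulas for $f(k)$ are understood for $k\ge 1$. A graph is $H$-free if it has no induced subgraph isomorphic to $H$. "Is an induced subgraph of" is understood up to isomorphism. $P_3$ is the path on three vertices. For positive integers $k,\ell$, $R(k,\ell)$ is the Ramsey number: the least positive integer such that every graph with at least $R(k,\ell)$ vertices contains a clique of size $k$ or an independent set of size $\ell$. *)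

theory Defs
  imports "HOL-Library.Ramsey" "HOL-Library.Infinite_Typeclass"
begin

section \<open>Finite simple graphs\<close>

text \<open>A graph is a pair of a vertex set and a set of two-element vertex sets, the format in which
  \<^theory>\<open>HOL-Library.Ramsey\<close> states \<^const>\<open>clique\<close> and \<^const>\<open>indep\<close>.\<close>

type_synonym 'a ugraph = "'a set \<times> 'a set set"

abbreviation vertices :: "'a ugraph \<Rightarrow> 'a set" where
  "vertices G \<equiv> fst G"

abbreviation edges :: "'a ugraph \<Rightarrow> 'a set set" where
  "edges G \<equiv> snd G"

definition graph :: "'a ugraph \<Rightarrow> bool" where
  "graph G \<longleftrightarrow> finite (vertices G) \<and> vertices G \<noteq> {} \<and> edges G \<subseteq> [vertices G]\<^bsup>2\<^esup>"

definition induced_subgraph :: "'a ugraph \<Rightarrow> 'a ugraph \<Rightarrow> bool" where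
  "induced_subgraph G' G \<longleftrightarrow>
     graph G' \<and> vertices G' \<subseteq> vertices G \<and> edges G' = {e \<in> edges G. e \<subseteq> vertices G'}"

definition graph_iso :: "'a ugraph \<Rightarrow> 'b ugraph \<Rightarrow> bool" where
  "graph_iso G H \<longleftrightarrow>
     (\<exists>f. bij_betw f (vertices G) (vertices H) \<and>
          (\<forall>u\<in>vertices G. \<forall>v\<in>vertices G. {u, v} \<in> edges G \<longleftrightarrow> {f u, f v} \<in> edges H))"

definition iso_induced_subgraph :: "'a ugraph \<Rightarrow> 'b ugraph \<Rightarrow> bool" where
  "iso_induced_subgraph H G \<longleftrightarrow> (\<exists>G'. induced_subgraph G' G \<and> graph_iso H G')"

text \<open>The class is relative to a type of vertices. Over an infinite type it contains an isomorphic
  copy of every finite \<open>H\<close>-free graph.\<close>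

definition free_graphs :: "'a ugraph \<Rightarrow> 'v ugraph set" where
  "free_graphs H = {G. graph G \<and> \<not> iso_induced_subgraph H G}"

definition edgeless :: "'a ugraph \<Rightarrow> bool" where
  "edgeless G \<longleftrightarrow> edges G = {}"

definition path_graph :: "nat \<Rightarrow> nat ugraph" where
  "path_graph n = ({..<n}, {{i, Suc i} | i. Suc i < n})"

definition clique_number :: "'a ugraph \<Rightarrow> nat" where
  "clique_number G = Max {card K | K. K \<subseteq> vertices G \<and> clique K (edges G)}"


section \<open>Treewidth\<close>

definition connected_graph :: "'a ugraph \<Rightarrow> bool" where
  "connected_graph G \<longleftrightarrow>
     (\<forall>u\<in>vertices G. \<forall>v\<in>vertices G. (u, v) \<in> {(x, y). {x, y} \<in> edges G}\<^sup>*)"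

definition is_cycle :: "'a ugraph \<Rightarrow> 'a list \<Rightarrow> bool" where
  "is_cycle G c \<longleftrightarrow>
     length c \<ge> 3 \<and> distinct c \<and> set c \<subseteq> vertices G \<and>
     (\<forall>i<length c. {c ! i, c ! (Suc i mod length c)} \<in> edges G)"

definition is_tree :: "'a ugraph \<Rightarrow> bool" where
  "is_tree T \<longleftrightarrow> graph T \<and> connected_graph T \<and> (\<nexists>c. is_cycle T c)"

definition tree_decomposition :: "'a ugraph \<Rightarrow> 't ugraph \<Rightarrow> ('t \<Rightarrow> 'a set) \<Rightarrow> bool" where
  "tree_decomposition G T \<beta> \<longleftrightarrow>
     is_tree T \<and>
     (\<Union>t\<in>vertices T. \<beta> t) = vertices G \<and>
     (\<forall>e\<in>edges G. \<exists>t\<in>vertices T. e \<subseteq> \<beta> t) \<and>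
     (\<forall>v\<in>vertices G.
        let S = {t \<in> vertices T. v \<in> \<beta> t} in connected_graph (S, {e \<in> edges T. e \<subseteq> S}))"

text \<open>Natural-number subtraction is harmless here: a graph has a vertex, so in a tree decomposition
  some bag is nonempty.\<close>

definition decomposition_width :: "'t ugraph \<Rightarrow> ('t \<Rightarrow> 'a set) \<Rightarrow> nat" where
  "decomposition_width T \<beta> = Max ((\<lambda>t. card (\<beta> t)) ` vertices T) - 1"

text \<open>Decomposition trees are finite, so their nodes may be taken to be natural numbers.\<close>

definition treewidth :: "'a ugraph \<Rightarrow> nat" where
  "treewidth G =
     (LEAST w. \<exists>(T :: nat ugraph) \<beta>. tree_decomposition G T \<beta> \<and> decomposition_width T \<beta> = w)"


section \<open>Treewidth bounded by clique number\<close>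

definition tw_omega_binding :: "(nat \<Rightarrow> nat) \<Rightarrow> 'v ugraph set \<Rightarrow> bool" where
  "tw_omega_binding f \<G> \<longleftrightarrow>
     (\<forall>G\<in>\<G>. \<forall>G'. induced_subgraph G' G \<longrightarrow> treewidth G' \<le> f (clique_number G'))"

definition tw_omega_bounded :: "'v ugraph set \<Rightarrow> bool" where
  "tw_omega_bounded \<G> \<longleftrightarrow> (\<exists>f. tw_omega_binding f \<G>)"


section \<open>Ramsey numbers\<close>

definition ramsey_number :: "nat \<Rightarrow> nat \<Rightarrow> nat" where
  "ramsey_number k l =
     (LEAST r. r \<ge> 1 \<and>
        (\<forall>G :: nat ugraph. graph G \<and> card (vertices G) \<ge> r \<longrightarrow>
           (\<exists>S \<subseteq> vertices G. card S = k \<and> clique S (edges G) \<or> card S = l \<and> indep S (edges G))))"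

end

theory Submission
  imports Defs
begin

text \<open>If \<open>H\<close> is edgeless, then an \<open>H\<close>-free graph has no independent set of size \<open>|V(H)|\<close>,
  so Ramsey's theorem bounds its number of vertices in terms of its clique number, and a
  decomposition with a single bag suffices. If \<open>H\<close> is an induced subgraph of \<open>P\<^sub>3\<close>, then adjacency in
  an \<open>H\<close>-free graph is transitive, so the graph is a disjoint union of cliques, and the cliques
  themselves are the bags. Both upper bounds come from one lemma, \<open>treewidth_le_parts\<close>.

  For the converse, two sequences of graphs have bounded clique number and unbounded treewidth. The
  complete bipartite graphs \<open>K\<^sub>n\<^sub>,\<^sub>n\<close> have the property that every vertex is adjacent to exactly one end
  of every edge; the ``thick grids'', which are line graphs of subdivided grids, contain neither an
  induced claw nor an induced four-cycle. If the \<open>H\<close>-free graphs are bounded, then \<open>H\<close> embeds in some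
  member of each sequence (\<open>unbounded_if_free_witnesses\<close>) and inherits all three properties. A short
  case analysis (\<open>pattern_free_in_path_3\<close>) shows that a graph with these properties and with an edge
  has at most one vertex beyond the ends of that edge, and so lies in \<open>P\<^sub>3\<close>.

  The treewidth of both sequences is bounded from below by a bramble. The decomposition nodes whose
  bags meet a connected set of vertices form a subtree, the subtrees of two touching sets intersect,
  and by the Helly property of subtrees a single bag meets all members of the bramble. Both
  sequences consist of graphs with \<open>n\<close> disjoint ``rows'' and \<open>n\<close> disjoint ``columns'', all connected,
  such that each row has an edge to each column; unions of a row and a column form a bramble, and a
  set of fewer than \<open>n\<close> vertices misses some row and some column
  (\<open>treewidth_ge_crossing_families\<close>).\<close>

section \<open>Induced subgraphs as embeddings\<close>

definition embedding :: "('a \<Rightarrow> 'b) \<Rightarrow> 'a ugraph \<Rightarrow> 'b ugraph \<Rightarrow> bool" where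
  "embedding f H G \<longleftrightarrow> inj_on f (vertices H) \<and> f ` vertices H \<subseteq> vertices G \<and>
     (\<forall>u\<in>vertices H. \<forall>v\<in>vertices H. {u, v} \<in> edges H \<longleftrightarrow> {f u, f v} \<in> edges G)"

lemma graph_edgeD:
  assumes "graph G" "{u, v} \<in> edges G"
  shows "u \<noteq> v" "u \<in> vertices G" "v \<in> vertices G"
proof -
  have "{u, v} \<in> [vertices G]\<^bsup>2\<^esup>"
    using assms unfolding graph_def by blast
  then show "u \<noteq> v" "u \<in> vertices G" "v \<in> vertices G"
    by simp_all
qed

lemma graph_edgeE:
  assumes "graph G" "e \<in> edges G"
  obtains u v where "e = {u, v}" "u \<noteq> v" "u \<in> vertices G" "v \<in> vertices G"
proof -
  have "e \<in> [vertices G]\<^bsup>2\<^esup>"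
    using assms by (auto simp: graph_def)
  then have "e \<subseteq> vertices G" "card e = 2"
    by (auto simp: nsets_def)
  then show thesis
    using that by (auto simp: card_2_iff)
qed

lemma embedding_iff:
  assumes "embedding f H G" "u \<in> vertices H" "v \<in> vertices H"
  shows "{f u, f v} \<in> edges G \<longleftrightarrow> {u, v} \<in> edges H"
  using assms by (auto simp: embedding_def)

lemma embedding_vertex:
  assumes "embedding f H G" "u \<in> vertices H"
  shows "f u \<in> vertices G"
  using assms by (auto simp: embedding_def)

lemma embedding_neq:
  assumes "embedding f H G" "u \<in> vertices H" "v \<in> vertices H" "u \<noteq> v"
  shows "f u \<noteq> f v"
  using assms by (auto simp: embedding_def inj_on_def)

lemma embedding_comp:
  assumes f: "embedding f H G" and g: "embedding g G K"
  shows "embedding (g \<circ> f) H K"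
proof -
  have "inj_on (g \<circ> f) (vertices H)"
    using f g unfolding embedding_def by (meson comp_inj_on inj_on_subset)
  then show ?thesis
    using f g unfolding embedding_def by (auto simp: image_subset_iff)
qed

text \<open>Embeddings compose and avoid the intermediate induced copy of \<open>H\<close>, so all later arguments about
  induced subgraphs are phrased in terms of them.\<close>

lemma iso_induced_subgraph_iff_embedding:
  assumes H: "graph H" and G: "graph G"
  shows "iso_induced_subgraph H G \<longleftrightarrow> (\<exists>f. embedding f H G)"
proof
  assume "iso_induced_subgraph H G"
  then obtain G' f where G': "induced_subgraph G' G" and f: "bij_betw f (vertices H) (vertices G')"
    and e: "\<forall>u\<in>vertices H. \<forall>v\<in>vertices H. {u, v} \<in> edges H \<longleftrightarrow> {f u, f v} \<in> edges G'"
    unfolding iso_induced_subgraph_def graph_iso_def by blast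
  have "f u \<in> vertices G'" if "u \<in> vertices H" for u
    using f that by (auto simp: bij_betw_def)
  then have "embedding f H G"
    using f e G' unfolding embedding_def induced_subgraph_def bij_betw_def by auto
  then show "\<exists>f. embedding f H G" by blast
next
  assume "\<exists>f. embedding f H G"
  then obtain f where f: "embedding f H G" ..
  let ?V = "f ` vertices H"
  let ?G' = "(?V, {e \<in> edges G. e \<subseteq> ?V})"
  have "graph ?G'"
    using H G unfolding graph_def by (auto simp: nsets_def)
  moreover have "?V \<subseteq> vertices G"
    using f by (auto simp: embedding_def)
  ultimately have "induced_subgraph ?G' G"
    by (simp add: induced_subgraph_def)
  moreover have "graph_iso H ?G'"
    unfolding graph_iso_def using f
    by (intro exI[of _ f]) (auto simp: embedding_def bij_betw_def)
  ultimately show "iso_induced_subgraph H G"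
    unfolding iso_induced_subgraph_def by blast
qed

lemma induced_subgraph_embedding:
  assumes "induced_subgraph G' G"
  shows "embedding id G' G"
  using assms by (auto simp: induced_subgraph_def embedding_def)

text \<open>Copies of a graph on another vertex type are needed twice: Ramsey numbers are defined by graphs on
  the natural numbers, and the graphs of large treewidth have to be moved into the given infinite
  type.\<close>

definition graph_image :: "('a \<Rightarrow> 'b) \<Rightarrow> 'a ugraph \<Rightarrow> 'b ugraph" where
  "graph_image f G = (f ` vertices G, (`) f ` edges G)"

lemma graph_image:
  assumes G: "graph G" and f: "inj_on f (vertices G)"
  shows "graph (graph_image f G)"
    and "embedding f G (graph_image f G)"
    and "embedding (inv_into (vertices G) f) (graph_image f G) G"
proof -
  have "f ` e \<in> [f ` vertices G]\<^bsup>2\<^esup>" if e: "e \<in> edges G" for e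
  proof -
    obtain u v where "e = {u, v}" "u \<noteq> v" "u \<in> vertices G" "v \<in> vertices G"
      using graph_edgeE[OF G e] by blast
    then show ?thesis
      using f by (auto simp: nsets_def inj_on_def card_2_iff)
  qed
  then show "graph (graph_image f G)"
    using G by (auto simp: graph_def graph_image_def)
  have iff: "{f u, f v} \<in> (`) f ` edges G \<longleftrightarrow> {u, v} \<in> edges G"
    if "u \<in> vertices G" "v \<in> vertices G" for u v
  proof
    assume "{f u, f v} \<in> (`) f ` edges G"
    then obtain e where e: "e \<in> edges G" "f ` {u, v} = f ` e" by auto
    moreover have "e \<subseteq> vertices G"
      using graph_edgeE[OF G e(1)] by blast
    ultimately have "e = {u, v}"
      using f that inj_on_image_eq_iff[of f "vertices G" "{u, v}" e] by auto
    then show "{u, v} \<in> edges G" using e by simp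
  next
    assume "{u, v} \<in> edges G"
    then have "f ` {u, v} \<in> (`) f ` edges G" by blast
    then show "{f u, f v} \<in> (`) f ` edges G" by simp
  qed
  then show "embedding f G (graph_image f G)"
    using f by (auto simp: embedding_def graph_image_def)
  show "embedding (inv_into (vertices G) f) (graph_image f G) G"
    using f iff
    by (auto simp: embedding_def graph_image_def inv_into_into inj_on_inv_into)
qed

lemma embedding_clique:
  assumes "embedding f G G'" "K \<subseteq> vertices G" "clique K (edges G)"
  shows "clique (f ` K) (edges G')" "f ` K \<subseteq> vertices G'" "card (f ` K) = card K"
  using assms unfolding embedding_def
  by (auto simp: clique_def subset_iff intro!: card_image inj_on_subset[of f "vertices G" K])

lemma embedding_indep:
  assumes "embedding f G G'" "K \<subseteq> vertices G" "indep K (edges G)"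
  shows "indep (f ` K) (edges G')" "f ` K \<subseteq> vertices G'" "card (f ` K) = card K"
  using assms unfolding embedding_def
  by (auto simp: indep_def subset_iff intro!: card_image inj_on_subset[of f "vertices G" K])

lemma clique_number_ge:
  assumes "graph G" "K \<subseteq> vertices G" "clique K (edges G)"
  shows "card K \<le> clique_number G"
proof -
  have "{card K |K. K \<subseteq> vertices G \<and> clique K (edges G)} \<subseteq> card ` Pow (vertices G)"
    by auto
  then have "finite {card K |K. K \<subseteq> vertices G \<and> clique K (edges G)}"
    using assms(1) by (auto simp: graph_def intro: finite_subset)
  then show ?thesis
    unfolding clique_number_def using assms by (intro Max_ge) auto
qed

lemma clique_number_le:
  assumes "graph G" "\<And>K. K \<subseteq> vertices G \<Longrightarrow> clique K (edges G) \<Longrightarrow> card K \<le> c"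
  shows "clique_number G \<le> c"
proof -
  have "{card K |K. K \<subseteq> vertices G \<and> clique K (edges G)} \<subseteq> card ` Pow (vertices G)"
    by auto
  then have "finite {card K |K. K \<subseteq> vertices G \<and> clique K (edges G)}"
    using assms(1) by (auto simp: graph_def intro: finite_subset)
  moreover have "{card K |K. K \<subseteq> vertices G \<and> clique K (edges G)} \<noteq> {}"
    by (auto simp: clique_def intro!: exI[of _ "{}"])
  ultimately show ?thesis
    unfolding clique_number_def using assms by (subst Max_le_iff) auto
qed

section \<open>Connected vertex sets\<close>

definition connected_in :: "'a ugraph \<Rightarrow> 'a set \<Rightarrow> bool" where
  "connected_in G S \<longleftrightarrow> connected_graph (S, {e \<in> edges G. e \<subseteq> S})"

definition steps :: "'a ugraph \<Rightarrow> 'a set \<Rightarrow> ('a \<times> 'a) set" where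
  "steps G S = {(x, y). {x, y} \<in> edges G \<and> x \<in> S \<and> y \<in> S}"

lemma connected_in_iff:
  "connected_in G S \<longleftrightarrow> (\<forall>u\<in>S. \<forall>v\<in>S. (u, v) \<in> (steps G S)\<^sup>*)"
  by (simp add: connected_in_def connected_graph_def steps_def)

lemma steps_rtrancl_mono:
  assumes "(u, v) \<in> (steps G S)\<^sup>*" "S \<subseteq> S'"
  shows "(u, v) \<in> (steps G S')\<^sup>*"
proof -
  have "steps G S \<subseteq> steps G S'" using assms(2) by (auto simp: steps_def)
  then show ?thesis using assms(1) rtrancl_mono by blast
qed

lemma steps_rtrancl_sym:
  assumes "(u, v) \<in> (steps G S)\<^sup>*"
  shows "(v, u) \<in> (steps G S)\<^sup>*"
proof -
  have "sym (steps G S)"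
    by (auto simp: sym_def steps_def insert_commute)
  then show ?thesis using assms by (metis sym_rtrancl symD)
qed

lemma connected_in_root:
  assumes "\<And>u. u \<in> S \<Longrightarrow> (r, u) \<in> (steps G S)\<^sup>*"
  shows "connected_in G S"
  unfolding connected_in_iff using assms by (meson steps_rtrancl_sym rtrancl_trans)

lemma connected_in_Un:
  assumes A: "connected_in G A" and B: "connected_in G B"
    and a: "a \<in> A" and b: "b \<in> B" and ab: "{a, b} \<in> edges G"
  shows "connected_in G (A \<union> B)"
proof (rule connected_in_root)
  fix u assume "u \<in> A \<union> B"
  then show "(a, u) \<in> (steps G (A \<union> B))\<^sup>*"
  proof
    assume "u \<in> A"
    then show ?thesis
      using A a steps_rtrancl_mono[of a u G A "A \<union> B"] by (auto simp: connected_in_iff)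
  next
    assume "u \<in> B"
    then have "(b, u) \<in> (steps G (A \<union> B))\<^sup>*"
      using B b steps_rtrancl_mono[of b u G B "A \<union> B"] by (auto simp: connected_in_iff)
    moreover have "(a, b) \<in> steps G (A \<union> B)"
      using a b ab by (auto simp: steps_def)
    ultimately show ?thesis by simp
  qed
qed

lemma connected_in_vertices:
  assumes "graph G" "connected_graph G"
  shows "connected_in G (vertices G)"
proof -
  have "{e \<in> edges G. e \<subseteq> vertices G} = edges G"
    using assms(1) by (auto simp: graph_def nsets_def)
  then show ?thesis using assms(2) by (simp add: connected_in_def)
qed

lemma connected_in_neighbour:
  assumes "connected_in G S" "t \<in> S" "u \<in> S" "u \<noteq> t"
  obtains s where "s \<in> S" "{t, s} \<in> edges G"
proof -
  have "(t, u) \<in> (steps G S)\<^sup>*"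
    using assms by (auto simp: connected_in_iff)
  then show thesis
    using assms(4) that by (cases rule: converse_rtranclE) (auto simp: steps_def)
qed

text \<open>A walk that enters the leaf \<open>t\<close> comes from \<open>s\<close> and returns to \<open>s\<close>, so the visit can be cut out. The
  induction along the walk therefore tracks the last vertex other than \<open>t\<close>. The set \<open>S\<close> is allowed to
  miss \<open>t\<close> or \<open>s\<close>, which lets the same lemma apply to a tree and to each of its subtrees.\<close>

lemma connected_in_remove_leaf:
  assumes G: "graph G" and S: "connected_in G S"
    and leaf: "\<And>x. x \<in> S \<Longrightarrow> {t, x} \<in> edges G \<Longrightarrow> x = s"
  shows "connected_in G (S - {t})"
  unfolding connected_in_iff
proof (intro ballI)
  fix u v assume u: "u \<in> S - {t}" and v: "v \<in> S - {t}"
  have "(u, v) \<in> (steps G S)\<^sup>*"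
    using S u v by (auto simp: connected_in_iff)
  \<comment> \<open>A walk standing at \<open>t\<close> is charged to \<open>s\<close>, from where it came.\<close>
  then have "(u, if v = t then s else v) \<in> (steps G (S - {t}))\<^sup>*"
  proof (induction rule: rtrancl_induct)
    case base
    then show ?case using u by simp
  next
    case (step v w)
    have vw: "{v, w} \<in> edges G" "{w, v} \<in> edges G" "v \<in> S" "w \<in> S"
      using step.hyps by (auto simp: steps_def insert_commute)
    have "v \<noteq> w" using graph_edgeD(1)[OF G vw(1)] .
    consider "v = t" | "w = t" "v \<noteq> t" | "v \<noteq> t" "w \<noteq> t" by blast
    then show ?case
    proof cases
      case 1
      then have "w = s" using leaf vw by auto
      then show ?thesis using 1 step.IH \<open>v \<noteq> w\<close> by auto
    next
      case 2
      then have "v = s" using leaf vw by auto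
      then show ?thesis using 2 step.IH by auto
    next
      case 3
      then have "(v, w) \<in> steps G (S - {t})" using vw by (auto simp: steps_def)
      then show ?thesis using 3 step.IH by (auto intro: rtrancl_into_rtrancl)
    qed
  qed
  then show "(u, v) \<in> (steps G (S - {t}))\<^sup>*" using v by auto
qed

section \<open>Subtrees and the Helly property\<close>

text \<open>The first vertex of a longest path is a leaf: a neighbour of it off the path would extend the path,
  and a neighbour further along the path would close a cycle.\<close>

lemma acyclic_connected_has_leaf:
  assumes G: "graph G" and acyc: "\<nexists>c. is_cycle G c"
    and W: "W \<subseteq> vertices G" "connected_in G W" and uv: "u \<in> W" "v \<in> W" "u \<noteq> v"
  obtains t s where "t \<in> W" "s \<in> W" "s \<noteq> t" "\<And>x. x \<in> W \<Longrightarrow> {t, x} \<in> edges G \<Longrightarrow> x = s"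
proof -
  define P where "P = {p. set p \<subseteq> W \<and> distinct p \<and> successively (\<lambda>x y. {x, y} \<in> edges G) p}"
  have finW: "finite W" using G W(1) by (auto simp: graph_def intro: finite_subset)
  have "finite P"
    unfolding P_def by (rule finite_subset[OF _ finite_subset_distinct[OF finW]]) auto
  obtain y where y: "y \<in> W" "{u, y} \<in> edges G"
    using connected_in_neighbour[OF W(2) uv(1) uv(2)] uv(3) by blast
  have "[u, y] \<in> P"
    using uv y graph_edgeD(1)[OF G y(2)] by (auto simp: P_def)
  obtain p where p: "p \<in> P" and max: "\<And>q. q \<in> P \<Longrightarrow> length q \<le> length p"
    using \<open>finite P\<close> \<open>[u, y] \<in> P\<close> Max_in[of "length ` P"] Max_ge[of "length ` P"]
    by (metis (no_types, lifting) empty_iff finite_imageI imageE image_eqI image_is_empty)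
  have "length p \<ge> 2" using max[OF \<open>[u, y] \<in> P\<close>] by simp
  then obtain t s r where tsr: "p = t # s # r"
    by (metis Suc_le_length_iff numeral_2_eq_2)
  have "x = s" if x: "x \<in> W" "{t, x} \<in> edges G" for x
  proof (rule ccontr)
    assume "x \<noteq> s"
    have "x \<noteq> t" using graph_edgeD(1)[OF G x(2)] by simp
    show False
    proof (cases "x \<in> set p")
      case False
      then have "x # p \<in> P"
        using p x tsr by (auto simp: P_def insert_commute)
      then show False using max by fastforce
    next
      case True
      then obtain k where k: "k < length p" "p ! k = x" by (auto simp: in_set_conv_nth)
      have "k \<noteq> 0" "k \<noteq> 1"
        using k tsr \<open>x \<noteq> s\<close> \<open>x \<noteq> t\<close> by (auto intro!: gr0I)
      then have k2: "k \<ge> 2" by simp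
      \<comment> \<open>The initial segment of the path up to \<open>x\<close>, closed by the edge from \<open>x\<close> back to \<open>t\<close>.\<close>
      let ?c = "take (Suc k) p"
      have len: "length ?c = Suc k" using k by simp
      have "{?c ! i, ?c ! (Suc i mod length ?c)} \<in> edges G" if i: "i < length ?c" for i
      proof (cases "i = k")
        case True
        moreover have "?c ! 0 = t" using tsr by simp
        ultimately show ?thesis using len k x by (simp add: insert_commute)
      next
        case False
        then have "Suc i < length p" "Suc i mod Suc k = Suc i" "i < k" using i len k by auto
        moreover have "{p ! i, p ! Suc i} \<in> edges G"
          using p calculation(1) by (auto simp: P_def successively_conv_nth)
        ultimately show ?thesis using len by simp
      qed
      moreover have "set ?c \<subseteq> vertices G"
        using p W(1) set_take_subset[of "Suc k" p] by (auto simp: P_def)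
      moreover have "distinct ?c" using p by (auto simp: P_def)
      ultimately have "is_cycle G ?c"
        using len k2 unfolding is_cycle_def by auto
      then show False using acyc by blast
    qed
  qed
  moreover have "t \<in> W" "s \<in> W" "s \<noteq> t" using p tsr by (auto simp: P_def)
  ultimately show thesis using that by blast
qed

text \<open>Remove a leaf \<open>t\<close> with neighbour \<open>s\<close>. If \<open>{t}\<close> is one of the subtrees, all of them contain \<open>t\<close>.
  Otherwise each subtree that contains \<open>t\<close> also contains \<open>s\<close>, so the subtrees stay connected and
  pairwise intersecting without \<open>t\<close>. The induction runs over connected vertex subsets \<open>W\<close> of one fixed
  tree, so that acyclicity need not be passed on to subgraphs.\<close>

lemma subtrees_Helly:
  assumes T: "graph T" and acyc: "\<nexists>c. is_cycle T c"
    and "W \<subseteq> vertices T" "W \<noteq> {}" "connected_in T W"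
    and "\<And>S. S \<in> \<S> \<Longrightarrow> S \<subseteq> W \<and> connected_in T S"
    and "\<And>S S'. S \<in> \<S> \<Longrightarrow> S' \<in> \<S> \<Longrightarrow> S \<inter> S' \<noteq> {}"
  shows "\<exists>t\<in>W. \<forall>S\<in>\<S>. t \<in> S"
  using assms(3-)
proof (induction "card W" arbitrary: W \<S> rule: less_induct)
  case less
  have finW: "finite W" using T less.prems(1) by (auto simp: graph_def intro: finite_subset)
  obtain u where u: "u \<in> W" using less.prems(2) by blast
  show ?case
  proof (cases "W = {u}")
    case True
    then show ?thesis using less.prems(4,5) by fastforce
  next
    case False
    then obtain v where "v \<in> W" "u \<noteq> v" using u by blast
    then obtain t s where ts: "t \<in> W" "s \<in> W" "s \<noteq> t"
      and leaf: "\<And>x. x \<in> W \<Longrightarrow> {t, x} \<in> edges T \<Longrightarrow> x = s"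
      using acyclic_connected_has_leaf[OF T acyc less.prems(1,3) u] by metis
    show ?thesis
    proof (cases "{t} \<in> \<S>")
      case True
      then have "\<forall>S\<in>\<S>. t \<in> S" using less.prems(5) by blast
      then show ?thesis using ts by blast
    next
      case False
      have s_in: "s \<in> S" if S: "S \<in> \<S>" "t \<in> S" for S
      proof -
        have SW: "S \<subseteq> W" "connected_in T S" using less.prems(4)[OF S(1)] by auto
        have "S \<noteq> {t}" using S False by auto
        then obtain x where "x \<in> S" "x \<noteq> t" using S by auto
        then obtain y where y: "y \<in> S" "{t, y} \<in> edges T"
          using connected_in_neighbour[OF SW(2) S(2)] by metis
        then show ?thesis using leaf[of y] SW by auto
      qed
      let ?\<S> = "(\<lambda>S. S - {t}) ` \<S>"
      have "card (W - {t}) < card W" using finW ts by (meson card_Diff1_less)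
      moreover have "W - {t} \<subseteq> vertices T" "W - {t} \<noteq> {}" using less.prems(1) ts by auto
      moreover have "connected_in T (W - {t})"
        by (rule connected_in_remove_leaf[OF T less.prems(3) leaf])
      moreover have "S \<subseteq> W - {t} \<and> connected_in T S" if S: "S \<in> ?\<S>" for S
      proof -
        obtain A where A: "A \<in> \<S>" "S = A - {t}" using S by blast
        have AW: "A \<subseteq> W" "connected_in T A" using less.prems(4)[OF A(1)] by auto
        have "connected_in T (A - {t})"
          by (rule connected_in_remove_leaf[OF T AW(2) leaf]) (use AW in auto)
        then show ?thesis using A AW by auto
      qed
      moreover have "S \<inter> S' \<noteq> {}" if SS: "S \<in> ?\<S>" "S' \<in> ?\<S>" for S S'
      proof -
        obtain A A' where A: "A \<in> \<S>" "A' \<in> \<S>" "S = A - {t}" "S' = A' - {t}"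
          using SS by blast
        then obtain z where z: "z \<in> A" "z \<in> A'" using less.prems(5)[OF A(1,2)] by auto
        show ?thesis
        proof (cases "z = t")
          case True
          then have "s \<in> A" "s \<in> A'" using z A(1,2) s_in by auto
          then show ?thesis using A(3,4) ts(3) by auto
        next
          case False
          then show ?thesis using A(3,4) z by auto
        qed
      qed
      ultimately have "\<exists>t'\<in>W - {t}. \<forall>S\<in>?\<S>. t' \<in> S"
        by (rule less.hyps)
      then show ?thesis by auto
    qed
  qed
qed

section \<open>Lower bounds for treewidth\<close>

lemma tree_decomposition_connected_in:
  assumes "tree_decomposition G T \<beta>" "v \<in> vertices G"
  shows "connected_in T {t \<in> vertices T. v \<in> \<beta> t}"
  using assms by (simp add: tree_decomposition_def connected_in_def Let_def)

text \<open>For a single vertex this is an axiom of tree decompositions. Along an edge of \<open>G\<close> inside \<open>B\<close>, the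
  subtrees of the two ends share the node whose bag contains the edge, so connectivity of \<open>B\<close> carries
  over to the union of the subtrees.\<close>

lemma bags_meeting_connected_set:
  assumes dec: "tree_decomposition G T \<beta>" and B: "B \<subseteq> vertices G" "connected_in G B"
  shows "connected_in T {t \<in> vertices T. \<beta> t \<inter> B \<noteq> {}}"
proof -
  let ?N = "{t \<in> vertices T. \<beta> t \<inter> B \<noteq> {}}"
  have one: "(s, t) \<in> (steps T ?N)\<^sup>*"
    if "v \<in> B" "s \<in> vertices T" "v \<in> \<beta> s" "t \<in> vertices T" "v \<in> \<beta> t" for v s t
  proof -
    have "(s, t) \<in> (steps T {t \<in> vertices T. v \<in> \<beta> t})\<^sup>*"
      using tree_decomposition_connected_in[OF dec, of v] that B(1)
      by (auto simp: connected_in_iff)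
    then show ?thesis
      by (rule steps_rtrancl_mono) (use that in auto)
  qed
  have "(s, t) \<in> (steps T ?N)\<^sup>*"
    if s: "v \<in> B" "s \<in> vertices T" "v \<in> \<beta> s" and t: "w \<in> B" "t \<in> vertices T" "w \<in> \<beta> t" for v w s t
  proof -
    have "(v, w) \<in> (steps G B)\<^sup>*" using B(2) s t by (auto simp: connected_in_iff)
    then show ?thesis using t
    proof (induction arbitrary: t rule: rtrancl_induct)
      case base
      then show ?case using one s by blast
    next
      case (step w x)
      have "{w, x} \<in> edges G" "w \<in> B" using step.hyps by (auto simp: steps_def)
      then obtain r where "r \<in> vertices T" "w \<in> \<beta> r" "x \<in> \<beta> r"
        using dec unfolding tree_decomposition_def by (metis insert_subset)
      then show ?case
        using step.IH[of r] one[of x r t] step.prems \<open>w \<in> B\<close> by (meson rtrancl_trans)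
    qed
  qed
  then show ?thesis unfolding connected_in_iff by blast
qed

text \<open>The easy direction of the duality between brambles and treewidth: the subtrees belonging to the
  members of \<open>\<B>\<close> intersect pairwise, and a node common to all of them exists by the Helly property.
  Taking \<open>B' = B\<close>, the hypothesis also asks for an edge inside each member.\<close>

lemma bramble_bag:
  assumes dec: "tree_decomposition G T \<beta>"
    and \<B>: "\<And>B. B \<in> \<B> \<Longrightarrow> B \<subseteq> vertices G \<and> connected_in G B"
    and touch: "\<And>B B'. B \<in> \<B> \<Longrightarrow> B' \<in> \<B> \<Longrightarrow> \<exists>x\<in>B. \<exists>y\<in>B'. {x, y} \<in> edges G"
  shows "\<exists>t\<in>vertices T. \<forall>B\<in>\<B>. \<beta> t \<inter> B \<noteq> {}"
proof -
  define N where "N B = {t \<in> vertices T. \<beta> t \<inter> B \<noteq> {}}" for B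
  have T: "graph T" "\<nexists>c. is_cycle T c" "connected_graph T"
    using dec by (auto simp: tree_decomposition_def is_tree_def)
  have "\<exists>t\<in>vertices T. \<forall>S\<in>N ` \<B>. t \<in> S"
  proof (rule subtrees_Helly[OF T(1,2)])
    show "vertices T \<noteq> {}" using T(1) by (simp add: graph_def)
    show "connected_in T (vertices T)" using connected_in_vertices T by blast
    show "S \<subseteq> vertices T \<and> connected_in T S" if "S \<in> N ` \<B>" for S
      using that bags_meeting_connected_set[OF dec] \<B> by (auto simp: N_def)
    show "S \<inter> S' \<noteq> {}" if SS: "S \<in> N ` \<B>" "S' \<in> N ` \<B>" for S S'
    proof -
      obtain B B' where B: "B \<in> \<B>" "B' \<in> \<B>" "S = N B" "S' = N B'" using SS by blast
      then obtain x y where "x \<in> B" "y \<in> B'" "{x, y} \<in> edges G" using touch by blast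
      moreover then obtain t where "t \<in> vertices T" "{x, y} \<subseteq> \<beta> t"
        using dec unfolding tree_decomposition_def by blast
      ultimately have "t \<in> N B \<inter> N B'" by (auto simp: N_def)
      then show ?thesis using B by blast
    qed
  qed simp
  then show ?thesis by (auto simp: N_def)
qed

text \<open>Stars are convenient decomposition trees for pairwise disjoint bags, because their shape is
  irrelevant then and acyclicity has a short proof: each edge contains the centre \<open>0\<close>, but a cycle has
  two edges without a common vertex or, if it is a triangle, no vertex on all three edges.\<close>

lemma star_is_tree:
  assumes "m > 0"
  shows "is_tree ({..<m}, {{0, i} |i. 0 < i \<and> i < m} :: nat set set)"
proof -
  let ?T = "({..<m}, {{0, i} |i. 0 < i \<and> i < m}) :: nat ugraph"
  have "graph ?T"
    using assms by (auto simp: graph_def nsets_def)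
  moreover have "connected_graph ?T"
  proof -
    have "(0, u) \<in> (steps ?T {..<m})\<^sup>*" if "u \<in> {..<m}" for u
    proof (cases "u = 0")
      case False
      then have "(0, u) \<in> steps ?T {..<m}" using that by (auto simp: steps_def)
      then show ?thesis by blast
    qed simp
    then have "connected_in ?T {..<m}" by (rule connected_in_root)
    moreover have "{e \<in> edges ?T. e \<subseteq> {..<m}} = edges ?T" by auto
    ultimately show ?thesis by (simp add: connected_in_def)
  qed
  moreover have "\<not> is_cycle ?T c" for c
  proof
    assume c: "is_cycle ?T c"
    then have len: "length c \<ge> 3" and d: "distinct c"
      and e: "\<And>i. i < length c \<Longrightarrow> {c ! i, c ! (Suc i mod length c)} \<in> edges ?T"
      by (auto simp: is_cycle_def)
    have zero: "c ! i = 0 \<or> c ! (Suc i mod length c) = 0" if "i < length c" for i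
      using e[OF that] by (auto simp: doubleton_eq_iff)
    have inj: "i = j" if "c ! i = 0" "c ! j = 0" "i < length c" "j < length c" for i j
      using that d by (metis nth_eq_iff_index_eq)
    have "Suc 0 mod length c = 1" "Suc 1 mod length c = 2" "0 < length c" "1 < length c"
      using len by auto
    then have "c ! 0 = 0 \<or> c ! 1 = 0" "c ! 1 = 0 \<or> c ! 2 = 0"
      using zero[of 0] zero[of 1] by metis+
    then have c1: "c ! 1 = 0" using inj[of 0 2] len by force
    then have "c ! 2 \<noteq> 0" using inj[of 1 2] len by force
    then have z: "c ! (3 mod length c) = 0" using zero[of 2] len by (auto simp: numeral_3_eq_3)
    have "3 mod length c < length c" using len by (intro mod_less_divisor) linarith
    then have "3 mod length c = 1" using inj[OF z c1] len by linarith
    then show False using len by (cases "length c = 3") auto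
  qed
  ultimately show ?thesis unfolding is_tree_def by blast
qed

lemma treewidth_le_decomposition_width:
  fixes T :: "nat ugraph"
  assumes "tree_decomposition G T \<beta>"
  shows "treewidth G \<le> decomposition_width T \<beta>"
  unfolding treewidth_def using assms by (intro Least_le) blast

text \<open>The parts are the bags of a decomposition along a star. Each vertex lies in one bag only, so its
  nodes are trivially connected.\<close>

lemma treewidth_le_parts:
  assumes G: "graph G" and fin: "finite \<P>" and cover: "\<Union>\<P> = vertices G"
    and disj: "pairwise disjnt \<P>"
    and edge: "\<And>e. e \<in> edges G \<Longrightarrow> \<exists>P\<in>\<P>. e \<subseteq> P"
    and card: "\<And>P. P \<in> \<P> \<Longrightarrow> card P \<le> k"
  shows "treewidth G \<le> k - 1"
proof -
  obtain \<beta> where \<beta>: "bij_betw \<beta> {..<card \<P>} \<P>"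
    using fin ex_bij_betw_nat_finite[of \<P>] by (auto simp: atLeast0LessThan)
  let ?m = "card \<P>"
  let ?T = "({..<?m}, {{0, i} |i. 0 < i \<and> i < ?m}) :: nat ugraph"
  have im: "\<beta> ` {..<?m} = \<P>" using \<beta> by (simp add: bij_betw_def)
  have "\<P> \<noteq> {}" using G cover by (auto simp: graph_def)
  then have m: "?m > 0" using fin by (simp add: card_gt_0_iff)
  have "connected_in ?T {t \<in> vertices ?T. v \<in> \<beta> t}" for v
  proof -
    have "s = t" if "s < ?m" "t < ?m" "v \<in> \<beta> s" "v \<in> \<beta> t" for s t
    proof -
      have "\<beta> s = \<beta> t"
      proof (rule ccontr)
        assume "\<beta> s \<noteq> \<beta> t"
        moreover have "\<beta> s \<in> \<P>" "\<beta> t \<in> \<P>" using that im by auto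
        ultimately have "disjnt (\<beta> s) (\<beta> t)" using disj by (simp add: pairwise_def)
        then show False using that by (auto simp: disjnt_iff)
      qed
      then show ?thesis using \<beta> that by (auto simp: bij_betw_def inj_on_def)
    qed
    then show ?thesis by (auto simp: connected_in_iff)
  qed
  moreover have "(\<Union>t\<in>{..<?m}. \<beta> t) = vertices G" using im cover by simp
  moreover have "\<exists>t\<in>{..<?m}. e \<subseteq> \<beta> t" if e: "e \<in> edges G" for e
  proof -
    obtain P where P: "P \<in> \<P>" "e \<subseteq> P" using edge[OF e] by auto
    have "P \<in> \<beta> ` {..<?m}" using P(1) by (simp only: im)
    then show ?thesis using P(2) by auto
  qed
  ultimately have "tree_decomposition G ?T \<beta>"
    using star_is_tree[OF m]
    by (simp add: tree_decomposition_def connected_in_def Let_def)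
  then have "treewidth G \<le> decomposition_width ?T \<beta>"
    by (rule treewidth_le_decomposition_width)
  also have "\<dots> \<le> k - 1"
  proof -
    have "Max ((\<lambda>t. card (\<beta> t)) ` {..<?m}) \<le> k"
      using m im card by (subst Max_le_iff) auto
    then show ?thesis by (simp add: decomposition_width_def)
  qed
  finally show ?thesis .
qed

lemma treewidth_le_card:
  assumes "graph G"
  shows "treewidth G \<le> card (vertices G) - 1"
  using assms
  by (intro treewidth_le_parts[of G "{vertices G}"]) (auto simp: graph_def nsets_def)

text \<open>The decomposition with a single bag shows that the minimum in the definition of treewidth is taken
  over a nonempty set.\<close>

lemma treewidth_attained:
  assumes G: "graph G"
  obtains T :: "nat ugraph" and \<beta> where "tree_decomposition G T \<beta>"
    "decomposition_width T \<beta> = treewidth G"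
proof -
  let ?T = "({..<1}, {{0, i} |i. 0 < i \<and> i < 1}) :: nat ugraph"
  have "tree_decomposition G ?T (\<lambda>_. vertices G)"
    using star_is_tree[of 1] G
    by (auto simp: tree_decomposition_def Let_def connected_graph_def graph_def nsets_def)
  then have "\<exists>w (T :: nat ugraph) \<beta>. tree_decomposition G T \<beta> \<and> decomposition_width T \<beta> = w"
    by blast
  then have "\<exists>(T :: nat ugraph) \<beta>. tree_decomposition G T \<beta> \<and> decomposition_width T \<beta> = treewidth G"
    unfolding treewidth_def by (rule LeastI_ex)
  then show thesis using that by blast
qed

lemma decomposition_width_ge:
  assumes "tree_decomposition G T \<beta>" "t \<in> vertices T"
  shows "card (\<beta> t) \<le> decomposition_width T \<beta> + 1"
proof -
  have "finite (vertices T)" using assms by (auto simp: tree_decomposition_def is_tree_def graph_def)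
  then have "card (\<beta> t) \<le> Max ((\<lambda>t. card (\<beta> t)) ` vertices T)"
    using assms(2) by (intro Max_ge) auto
  then show ?thesis by (simp add: decomposition_width_def)
qed

lemma card_ge_if_meets_disjoint_family:
  assumes "finite X" "\<And>i. i < n \<Longrightarrow> X \<inter> R i \<noteq> {}"
    and "\<And>i j. i < n \<Longrightarrow> j < n \<Longrightarrow> i \<noteq> j \<Longrightarrow> R i \<inter> R j = {}"
  shows "n \<le> card X"
proof -
  obtain x where x: "\<And>i. i < n \<Longrightarrow> x i \<in> X \<inter> R i"
    using assms(2) unfolding ex_in_conv[symmetric] by metis
  then have "inj_on x {..<n}"
    using assms(3) unfolding inj_on_def by (metis IntD2 disjoint_iff lessThan_iff)
  moreover have "x ` {..<n} \<subseteq> X" using x by auto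
  ultimately show ?thesis using card_inj_on_le[OF _ _ assms(1)] by fastforce
qed

text \<open>The unions of a row \<open>R i\<close> and a column \<open>C j\<close> form a bramble, since any row touches any column. A bag
  that meets all of them cannot miss both a row and a column, so it meets all rows or all columns, and
  these are disjoint.\<close>

lemma treewidth_ge_crossing_families:
  fixes R C :: "nat \<Rightarrow> 'a set"
  assumes G: "graph G"
    and R: "\<And>i. i < n \<Longrightarrow> R i \<subseteq> vertices G \<and> connected_in G (R i)"
    and C: "\<And>i. i < n \<Longrightarrow> C i \<subseteq> vertices G \<and> connected_in G (C i)"
    and disjR: "\<And>i j. i < n \<Longrightarrow> j < n \<Longrightarrow> i \<noteq> j \<Longrightarrow> R i \<inter> R j = {}"
    and disjC: "\<And>i j. i < n \<Longrightarrow> j < n \<Longrightarrow> i \<noteq> j \<Longrightarrow> C i \<inter> C j = {}"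
    and cross: "\<And>i j. i < n \<Longrightarrow> j < n \<Longrightarrow> \<exists>x\<in>R i. \<exists>y\<in>C j. {x, y} \<in> edges G"
  shows "n \<le> treewidth G + 1"
proof -
  obtain T :: "nat ugraph" and \<beta> where dec: "tree_decomposition G T \<beta>"
    and w: "decomposition_width T \<beta> = treewidth G"
    using treewidth_attained[OF G] .
  define \<B> where "\<B> = {R i \<union> C j |i j. i < n \<and> j < n}"
  have "\<exists>t\<in>vertices T. \<forall>B\<in>\<B>. \<beta> t \<inter> B \<noteq> {}"
  proof (rule bramble_bag[OF dec])
    fix B assume "B \<in> \<B>"
    then obtain i j where ij: "i < n" "j < n" "B = R i \<union> C j" by (auto simp: \<B>_def)
    obtain x y where "x \<in> R i" "y \<in> C j" "{x, y} \<in> edges G"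
      using cross[OF ij(1,2)] by blast
    then have "connected_in G (R i \<union> C j)"
      using connected_in_Un R C ij by metis
    then show "B \<subseteq> vertices G \<and> connected_in G B"
      using R C ij by auto
    fix B' assume "B' \<in> \<B>"
    then obtain i' j' where "i' < n" "j' < n" "B' = R i' \<union> C j'" by (auto simp: \<B>_def)
    then show "\<exists>x\<in>B. \<exists>y\<in>B'. {x, y} \<in> edges G"
      using ij cross[of i j'] by blast
  qed
  then obtain t where t: "t \<in> vertices T" and hit: "\<And>B. B \<in> \<B> \<Longrightarrow> \<beta> t \<inter> B \<noteq> {}" by blast
  have "finite (\<beta> t)"
    using dec t G by (auto simp: tree_decomposition_def graph_def intro: finite_subset)
  moreover have "(\<forall>i<n. \<beta> t \<inter> R i \<noteq> {}) \<or> (\<forall>j<n. \<beta> t \<inter> C j \<noteq> {})"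
  proof (rule ccontr)
    assume "\<not> ?thesis"
    then obtain i j where "i < n" "j < n" "\<beta> t \<inter> R i = {}" "\<beta> t \<inter> C j = {}" by blast
    then show False using hit[of "R i \<union> C j"] by (auto simp: \<B>_def)
  qed
  ultimately have "n \<le> card (\<beta> t)"
    using card_ge_if_meets_disjoint_family[of "\<beta> t" n] disjR disjC by metis
  then show ?thesis using decomposition_width_ge[OF dec t] w by linarith
qed

text \<open>A decomposition of \<open>G'\<close> pulls back along the embedding by taking preimages of bags.\<close>

lemma treewidth_mono:
  assumes G: "graph G" and G': "graph G'" and f: "embedding f G G'"
  shows "treewidth G \<le> treewidth G'"
proof -
  obtain T :: "nat ugraph" and \<beta> where dec: "tree_decomposition G' T \<beta>"
    and w: "decomposition_width T \<beta> = treewidth G'"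
    using treewidth_attained[OF G'] .
  define \<gamma> where "\<gamma> t = {v \<in> vertices G. f v \<in> \<beta> t}" for t
  have T: "is_tree T" "(\<Union>t\<in>vertices T. \<beta> t) = vertices G'"
    and e: "\<And>e. e \<in> edges G' \<Longrightarrow> \<exists>t\<in>vertices T. e \<subseteq> \<beta> t"
    using dec by (auto simp: tree_decomposition_def)
  have "(\<Union>t\<in>vertices T. \<gamma> t) = vertices G"
    using T(2) embedding_vertex[OF f] by (auto simp: \<gamma>_def)
  moreover have "\<exists>t\<in>vertices T. e \<subseteq> \<gamma> t" if ee: "e \<in> edges G" for e
  proof -
    obtain u v where uv: "e = {u, v}" "u \<in> vertices G" "v \<in> vertices G"
      using graph_edgeE[OF G ee] by blast
    then have "{f u, f v} \<in> edges G'" using embedding_iff[OF f] ee by simp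
    then obtain t where "t \<in> vertices T" "{f u, f v} \<subseteq> \<beta> t" using e by blast
    then show ?thesis using uv by (auto simp: \<gamma>_def)
  qed
  moreover have "connected_in T {t \<in> vertices T. v \<in> \<gamma> t}" if "v \<in> vertices G" for v
    using tree_decomposition_connected_in[OF dec embedding_vertex[OF f that]] that
    by (simp add: \<gamma>_def)
  ultimately have dec': "tree_decomposition G T \<gamma>"
    using T(1) by (simp add: tree_decomposition_def connected_in_def Let_def)
  have card: "card (\<gamma> t) \<le> treewidth G' + 1" if t: "t \<in> vertices T" for t
  proof -
    have "finite (\<beta> t)"
      using T(2) t G' by (auto simp: graph_def intro: finite_subset)
    moreover have "inj_on f (\<gamma> t)"
      using f by (auto simp: embedding_def \<gamma>_def inj_on_def)
    ultimately have "card (\<gamma> t) \<le> card (\<beta> t)"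
      by (intro card_inj_on_le) (auto simp: \<gamma>_def)
    then show ?thesis using decomposition_width_ge[OF dec t] w by linarith
  qed
  have "finite (vertices T)" "vertices T \<noteq> {}"
    using T(1) by (auto simp: is_tree_def graph_def)
  then have "Max ((\<lambda>t. card (\<gamma> t)) ` vertices T) \<le> treewidth G' + 1"
    using card by (subst Max_le_iff) auto
  then have "decomposition_width T \<gamma> \<le> treewidth G'"
    by (simp add: decomposition_width_def)
  then show ?thesis
    using treewidth_le_decomposition_width[OF dec'] by linarith
qed

section \<open>The two binding functions\<close>

lemma path_graph_3_edges: "edges (path_graph 3) = {{0, 1}, {1, 2}}"
proof -
  have "Suc i < 3 \<longleftrightarrow> i = 0 \<or> i = 1" for i by auto
  then show ?thesis by (auto simp: path_graph_def numeral_2_eq_2)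
qed

lemma path_graph_3_vertices: "vertices (path_graph 3) = {0, 1, 2}"
  by (auto simp: path_graph_def)

lemma graph_path_graph_3: "graph (path_graph 3)"
  unfolding graph_def path_graph_3_edges path_graph_3_vertices by simp

lemma path_graph_3_embedding:
  assumes G: "graph G" and e: "{u, v} \<in> edges G" "{v, w} \<in> edges G" "u \<noteq> w" "{u, w} \<notin> edges G"
  shows "embedding (\<lambda>i. if i = 0 then u else if i = 1 then v else w) (path_graph 3) G"
proof -
  have "u \<noteq> v" "v \<noteq> w" "{u, v, w} \<subseteq> vertices G"
    using graph_edgeD[OF G e(1)] graph_edgeD[OF G e(2)] by auto
  moreover have "{x, x} \<notin> edges G" for x
    using graph_edgeD(1)[OF G, of x x] by auto
  ultimately show ?thesis
    using e unfolding embedding_def path_graph_3_edges path_graph_3_vertices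
    by (auto simp: doubleton_eq_iff insert_commute)
qed

text \<open>Transitive adjacency makes the closed neighbourhoods \<open>N v\<close> the classes of an equivalence relation;
  they are cliques and serve as the parts of \<open>treewidth_le_parts\<close>.\<close>

lemma treewidth_cluster_graph:
  assumes G: "graph G"
    and trans: "\<And>u v w. {u, v} \<in> edges G \<Longrightarrow> {v, w} \<in> edges G \<Longrightarrow> u \<noteq> w \<Longrightarrow> {u, w} \<in> edges G"
  shows "treewidth G \<le> clique_number G - 1"
proof -
  define N where "N v = {u \<in> vertices G. u = v \<or> {u, v} \<in> edges G}" for v
  have N_eq: "N u = N v" if "x \<in> N u" "x \<in> N v" "u \<in> vertices G" "v \<in> vertices G" for u v x
  proof -
    have le: "N u \<subseteq> N v" if "x \<in> N u" "x \<in> N v" "u \<in> vertices G" "v \<in> vertices G" for u v x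
    proof -
      have "u = v \<or> {u, v} \<in> edges G"
        using that trans[of u x v] by (auto simp: N_def insert_commute)
      then show ?thesis using trans[of _ u v] by (auto simp: N_def)
    qed
    show ?thesis using le[OF that] le[OF that(2,1,4,3)] by blast
  qed
  show ?thesis
  proof (rule treewidth_le_parts[OF G, of "N ` vertices G"])
    show "finite (N ` vertices G)" using G by (simp add: graph_def)
    show "\<Union> (N ` vertices G) = vertices G" by (auto simp: N_def)
    show "pairwise disjnt (N ` vertices G)"
      unfolding pairwise_def disjnt_iff using N_eq by blast
    show "\<exists>P\<in>N ` vertices G. e \<subseteq> P" if e: "e \<in> edges G" for e
    proof -
      obtain u v where "e = {u, v}" "u \<in> vertices G" "v \<in> vertices G"
        using graph_edgeE[OF G e] by blast
      then show ?thesis using e by (auto simp: N_def intro!: bexI[of _ v])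
    qed
    show "card P \<le> clique_number G" if PN: "P \<in> N ` vertices G" for P
    proof (rule clique_number_ge[OF G])
      obtain v where P: "P = N v" using PN by blast
      show "P \<subseteq> vertices G" by (auto simp: P N_def)
      show "clique P (edges G)"
        using trans[of _ v] by (auto simp: P N_def clique_def insert_commute)
    qed
  qed
qed

text \<open>Ramsey's theorem makes the set of candidates in the definition nonempty; a copy of \<open>G\<close> on the natural
  numbers transfers the defining property of the minimum to \<open>G\<close>.\<close>

lemma ramsey_number_works:
  fixes G :: "'a ugraph"
  assumes G: "graph G" and card: "card (vertices G) \<ge> ramsey_number k l"
  shows "\<exists>S \<subseteq> vertices G. card S = k \<and> clique S (edges G) \<or> card S = l \<and> indep S (edges G)"
proof -
  let ?Q = "\<lambda>r. r \<ge> 1 \<and> (\<forall>G :: nat ugraph. graph G \<and> card (vertices G) \<ge> r \<longrightarrow>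
     (\<exists>S \<subseteq> vertices G. card S = k \<and> clique S (edges G) \<or> card S = l \<and> indep S (edges G)))"
  obtain r where "r \<ge> 1" "\<And>(V :: nat set) E. finite V \<and> card V \<ge> r \<Longrightarrow>
      \<exists>S\<subseteq>V. card S = k \<and> clique S E \<or> card S = l \<and> indep S E"
    using ramsey2[of k l, where ?'a = nat] by blast
  then have "?Q r" by (auto simp: graph_def)
  then have *: "?Q (ramsey_number k l)"
    unfolding ramsey_number_def by (rule LeastI)
  have "finite (vertices G)" using G by (simp add: graph_def)
  then obtain h :: "'a \<Rightarrow> nat" where h: "inj_on h (vertices G)"
    using finite_imp_inj_to_nat_seg[of "vertices G"] by auto
  let ?G' = "graph_image h G"
  note img = graph_image[OF G h]
  have "card (vertices ?G') = card (vertices G)"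
    using h by (simp add: graph_image_def card_image)
  then obtain S where "S \<subseteq> vertices ?G'"
    "card S = k \<and> clique S (edges ?G') \<or> card S = l \<and> indep S (edges ?G')"
    using * img(1) card by metis
  then show ?thesis
    using embedding_clique[OF img(3), of S] embedding_indep[OF img(3), of S] by metis
qed

lemma edgeless_embedding_indep:
  assumes H: "graph H" "edgeless H" and G: "graph G"
    and S: "S \<subseteq> vertices G" "card S = card (vertices H)" "indep S (edges G)"
  shows "\<exists>f. embedding f H G"
proof -
  have fin: "finite S" "finite (vertices H)" using G H S by (auto simp: graph_def intro: finite_subset)
  then obtain f where f: "bij_betw f (vertices H) S"
    using S(2) finite_same_card_bij by metis
  have "{f u, f v} \<notin> edges G" if "u \<in> vertices H" "v \<in> vertices H" for u v
    using that f S(3) graph_edgeD(1)[OF G, of "f u" "f v"] by (auto simp: indep_def bij_betw_def)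
  then have "embedding f H G"
    using f S(1) H(2) by (auto simp: embedding_def edgeless_def bij_betw_def)
  then show ?thesis by blast
qed

lemma binding_path_3:
  assumes H: "graph H" and P3: "iso_induced_subgraph H (path_graph 3)"
  shows "tw_omega_binding (\<lambda>k. k - 1) (free_graphs H)"
  unfolding tw_omega_binding_def
proof (intro ballI allI impI)
  fix G :: "'v ugraph" and G' assume G: "G \<in> free_graphs H" and G': "induced_subgraph G' G"
  have gr: "graph G" "graph G'" using G G' by (auto simp: free_graphs_def induced_subgraph_def)
  obtain f where f: "embedding f H (path_graph 3)"
    using P3 iso_induced_subgraph_iff_embedding[OF H] graph_path_graph_3
    by blast
  show "treewidth G' \<le> clique_number G' - 1"
  proof (rule treewidth_cluster_graph[OF gr(2)], rule ccontr)
    fix u v w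
    assume "{u, v} \<in> edges G'" "{v, w} \<in> edges G'" "u \<noteq> w" "{u, w} \<notin> edges G'"
    then obtain g where "embedding g (path_graph 3) G'"
      using path_graph_3_embedding[OF gr(2)] by blast
    then have "embedding (id \<circ> (g \<circ> f)) H G"
      using embedding_comp[OF embedding_comp[OF f] induced_subgraph_embedding[OF G']] by simp
    then have "iso_induced_subgraph H G"
      using iso_induced_subgraph_iff_embedding[OF H gr(1)] by blast
    then show False using G by (simp add: free_graphs_def)
  qed
qed

lemma binding_edgeless:
  assumes H: "graph H" "edgeless H"
  shows "tw_omega_binding (\<lambda>k. ramsey_number (k + 1) (card (vertices H)) - 2) (free_graphs H)"
  unfolding tw_omega_binding_def
proof (intro ballI allI impI)
  fix G :: "'v ugraph" and G' assume G: "G \<in> free_graphs H" and G': "induced_subgraph G' G"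
  have gr: "graph G" "graph G'" using G G' by (auto simp: free_graphs_def induced_subgraph_def)
  let ?R = "ramsey_number (clique_number G' + 1) (card (vertices H))"
  have "card (vertices G') < ?R"
  proof (rule ccontr)
    assume "\<not> ?thesis"
    then obtain S where S: "S \<subseteq> vertices G'"
      "card S = clique_number G' + 1 \<and> clique S (edges G') \<or>
       card S = card (vertices H) \<and> indep S (edges G')"
      using ramsey_number_works[OF gr(2), of "clique_number G' + 1" "card (vertices H)"] by auto
    have "\<not> (card S = clique_number G' + 1 \<and> clique S (edges G'))"
      using clique_number_ge[OF gr(2) S(1)] by auto
    then obtain f where "embedding f H G'"
      using S edgeless_embedding_indep[OF H gr(2) S(1)] by blast
    then have "embedding (id \<circ> f) H G"
      using embedding_comp[OF _ induced_subgraph_embedding[OF G']] by simp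
    then have "iso_induced_subgraph H G"
      using iso_induced_subgraph_iff_embedding[OF H(1) gr(1)] by blast
    then show False using G by (simp add: free_graphs_def)
  qed
  then show "treewidth G' \<le> ?R - 2"
    using treewidth_le_card[OF gr(2)] by linarith
qed

section \<open>Forbidden patterns\<close>

text \<open>Each end of an edge is adjacent to exactly one end of it anyway, so \<open>z\<close> may range over all vertices.
  The condition excludes triangles and an edge plus an isolated vertex as induced subgraphs. For graphs
  with an edge it characterises the complete bipartite graphs.\<close>

definition edge_splitting :: "'a ugraph \<Rightarrow> bool" where
  "edge_splitting G \<longleftrightarrow> (\<forall>x\<in>vertices G. \<forall>y\<in>vertices G. \<forall>z\<in>vertices G.
     {x, y} \<in> edges G \<longrightarrow> ({x, z} \<in> edges G) \<noteq> ({y, z} \<in> edges G))"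

definition claw_free :: "'a ugraph \<Rightarrow> bool" where
  "claw_free G \<longleftrightarrow> (\<forall>x\<in>vertices G. \<forall>a\<in>vertices G. \<forall>b\<in>vertices G. \<forall>c\<in>vertices G.
     {x, a} \<in> edges G \<and> {x, b} \<in> edges G \<and> {x, c} \<in> edges G \<and> a \<noteq> b \<and> a \<noteq> c \<and> b \<noteq> c \<longrightarrow>
     {a, b} \<in> edges G \<or> {a, c} \<in> edges G \<or> {b, c} \<in> edges G)"

definition square_free :: "'a ugraph \<Rightarrow> bool" where
  "square_free G \<longleftrightarrow> (\<forall>a\<in>vertices G. \<forall>b\<in>vertices G. \<forall>c\<in>vertices G. \<forall>d\<in>vertices G.
     {a, b} \<in> edges G \<and> {b, c} \<in> edges G \<and> {c, d} \<in> edges G \<and> {d, a} \<in> edges G \<and>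
     a \<noteq> c \<and> b \<noteq> d \<longrightarrow> {a, c} \<in> edges G \<or> {b, d} \<in> edges G)"

lemma edge_splitting_embedding:
  assumes f: "embedding f H G" and G: "edge_splitting G"
  shows "edge_splitting H"
  unfolding edge_splitting_def
proof (intro ballI impI)
  fix x y z
  assume v: "x \<in> vertices H" "y \<in> vertices H" "z \<in> vertices H" and "{x, y} \<in> edges H"
  then have "({f x, f z} \<in> edges G) \<noteq> ({f y, f z} \<in> edges G)"
    using G[unfolded edge_splitting_def, rule_format, of "f x" "f y" "f z"]
    by (simp add: embedding_iff[OF f] embedding_vertex[OF f])
  then show "({x, z} \<in> edges H) \<noteq> ({y, z} \<in> edges H)"
    using v by (simp add: embedding_iff[OF f])
qed

lemma claw_free_embedding:
  assumes f: "embedding f H G" and G: "claw_free G"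
  shows "claw_free H"
  unfolding claw_free_def
proof (intro ballI impI, elim conjE)
  fix x a b c
  assume v: "x \<in> vertices H" "a \<in> vertices H" "b \<in> vertices H" "c \<in> vertices H"
    and "{x, a} \<in> edges H" "{x, b} \<in> edges H" "{x, c} \<in> edges H" "a \<noteq> b" "a \<noteq> c" "b \<noteq> c"
  then have "{f a, f b} \<in> edges G \<or> {f a, f c} \<in> edges G \<or> {f b, f c} \<in> edges G"
    using G[unfolded claw_free_def, rule_format, of "f x" "f a" "f b" "f c"]
    by (simp add: embedding_iff[OF f] embedding_vertex[OF f] embedding_neq[OF f])
  then show "{a, b} \<in> edges H \<or> {a, c} \<in> edges H \<or> {b, c} \<in> edges H"
    using v by (simp add: embedding_iff[OF f])
qed

lemma square_free_embedding:
  assumes f: "embedding f H G" and G: "square_free G"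
  shows "square_free H"
  unfolding square_free_def
proof (intro ballI impI, elim conjE)
  fix a b c d
  assume v: "a \<in> vertices H" "b \<in> vertices H" "c \<in> vertices H" "d \<in> vertices H"
    and "{a, b} \<in> edges H" "{b, c} \<in> edges H" "{c, d} \<in> edges H" "{d, a} \<in> edges H"
      "a \<noteq> c" "b \<noteq> d"
  then have "{f a, f c} \<in> edges G \<or> {f b, f d} \<in> edges G"
    using G[unfolded square_free_def, rule_format, of "f a" "f b" "f c" "f d"]
    by (simp add: embedding_iff[OF f] embedding_vertex[OF f] embedding_neq[OF f])
  then show "{a, c} \<in> edges H \<or> {b, d} \<in> edges H"
    using v by (simp add: embedding_iff[OF f])
qed

text \<open>Let \<open>uv\<close> be an edge. Every other vertex is adjacent to exactly one of \<open>u\<close> and \<open>v\<close>. Two of them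
  adjacent to \<open>u\<close> would form a claw with \<open>u\<close> and \<open>v\<close>, and likewise for \<open>v\<close>. If \<open>w\<close> is adjacent to \<open>u\<close>
  and \<open>w'\<close> to \<open>v\<close>, then splitting the edge \<open>vw'\<close> forces \<open>w\<close> and \<open>w'\<close> to be adjacent, which gives an
  induced four-cycle. So at most one further vertex exists.\<close>

lemma pattern_free_in_path_3:
  assumes H: "graph H" and "\<not> edgeless H"
    and split: "edge_splitting H" and claw: "claw_free H" and square: "square_free H"
  shows "iso_induced_subgraph H (path_graph 3)"
proof -
  obtain e where e: "e \<in> edges H" using \<open>\<not> edgeless H\<close> by (auto simp: edgeless_def)
  obtain u v where uv: "{u, v} \<in> edges H" "u \<noteq> v" "u \<in> vertices H" "v \<in> vertices H"
    using graph_edgeE[OF H e] e by metis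
  have sp: "{x, z} \<in> edges H \<longleftrightarrow> {y, z} \<notin> edges H" if "{x, y} \<in> edges H" "z \<in> vertices H" for x y z
    using split that graph_edgeD[OF H that(1)] unfolding edge_splitting_def by blast
  have no_two: False
    if xy: "{x, y} \<in> edges H" and w: "w \<in> vertices H" "w' \<in> vertices H" "w \<noteq> w'" "w \<noteq> y" "w' \<noteq> y"
      and adj: "{x, w} \<in> edges H" "{x, w'} \<in> edges H" for x y w w'
  proof -
    have "{y, w} \<notin> edges H" "{y, w'} \<notin> edges H" "{w, w'} \<notin> edges H"
      using sp[OF xy w(1)] sp[OF xy w(2)] sp[OF adj(1) w(2)] adj by auto
    then show False
      using claw[unfolded claw_free_def, rule_format, of x y w w'] graph_edgeD[OF H xy] w xy adj
      by auto
  qed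
  have no_cross: False
    if w: "w \<in> vertices H" "w' \<in> vertices H" "w \<noteq> v" "w' \<noteq> u" "{u, w} \<in> edges H" "{v, w'} \<in> edges H" for w w'
  proof -
    have n: "{v, w} \<notin> edges H" "{u, w'} \<notin> edges H"
      using sp[OF uv(1)] w by auto
    then have "{w', w} \<in> edges H" using sp[OF w(6,1)] by blast
    then show False
      using square[unfolded square_free_def, rule_format, of w u v w'] uv w n
      by (auto simp: insert_commute)
  qed
  have unique: "w = w'" if w: "w \<in> vertices H - {u, v}" "w' \<in> vertices H - {u, v}" for w w'
  proof (rule ccontr)
    assume "w \<noteq> w'"
    have "{u, w} \<in> edges H \<or> {v, w} \<in> edges H" "{u, w'} \<in> edges H \<or> {v, w'} \<in> edges H"
      using sp[OF uv(1)] w by auto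
    moreover have "{v, u} \<in> edges H" using uv by (simp add: insert_commute)
    ultimately show False
      using no_two[OF uv(1), of w w'] no_two[of v u w w'] no_cross[of w w'] no_cross[of w' w] w \<open>w \<noteq> w'\<close>
      by blast
  qed
  have loop: "{x, x} \<notin> edges H" for x using graph_edgeD(1)[OF H, of x x] by auto
  have three: "\<exists>f. embedding f H (path_graph 3)"
    if xy: "{x, y} \<in> edges H" and V: "vertices H = {x, y, w}" and w: "w \<noteq> x" "w \<noteq> y" "{x, w} \<in> edges H"
    for x y w
  proof -
    have "{y, w} \<notin> edges H" using sp[OF xy, of w] w V by auto
    then have "embedding (\<lambda>z. if z = w then 0 else if z = x then 1 else 2) H (path_graph 3)"
      using xy w graph_edgeD(1)[OF H xy] loop unfolding embedding_def path_graph_3_vertices path_graph_3_edges V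
      by (auto simp: doubleton_eq_iff insert_commute inj_on_def)
    then show ?thesis by blast
  qed
  have "\<exists>f. embedding f H (path_graph 3)"
  proof (cases "vertices H = {u, v}")
    case True
    then have "embedding (\<lambda>z. if z = u then 0 else 1) H (path_graph 3)"
      using uv loop unfolding embedding_def path_graph_3_vertices path_graph_3_edges True
      by (auto simp: doubleton_eq_iff insert_commute inj_on_def)
    then show ?thesis by blast
  next
    case False
    then obtain w where w: "w \<in> vertices H - {u, v}" using uv by blast
    then have "vertices H = {u, v, w}" "vertices H = {v, u, w}" using unique uv by blast+
    moreover have "{u, w} \<in> edges H \<or> {v, w} \<in> edges H" using sp[OF uv(1)] w by auto
    ultimately show ?thesis
      using three[of u v w] three[of v u w] uv w by (auto simp: insert_commute)
  qed
  then show ?thesis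
    using iso_induced_subgraph_iff_embedding[OF H] graph_path_graph_3
    by blast
qed

section \<open>Graphs of large treewidth and small clique number\<close>

definition graph_of :: "'a set \<Rightarrow> ('a \<Rightarrow> 'a \<Rightarrow> bool) \<Rightarrow> 'a ugraph" where
  "graph_of V adj = (V, {{x, y} |x y. x \<in> V \<and> y \<in> V \<and> adj x y})"

lemma vertices_graph_of [simp]: "vertices (graph_of V adj) = V"
  by (simp add: graph_of_def)

lemma edges_graph_of:
  assumes "symp adj"
  shows "{x, y} \<in> edges (graph_of V adj) \<longleftrightarrow> x \<in> V \<and> y \<in> V \<and> adj x y"
  using assms by (auto simp: graph_of_def doubleton_eq_iff dest: sympD)

lemma graph_graph_of:
  assumes "finite V" "V \<noteq> {}" "irreflp adj"
  shows "graph (graph_of V adj)"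
  using assms by (auto simp: graph_def graph_of_def irreflp_def)

definition complete_bipartite :: "nat \<Rightarrow> (bool \<times> nat) ugraph" where
  "complete_bipartite n = graph_of (UNIV \<times> {..<n}) (\<lambda>x y. fst x \<noteq> fst y)"

lemma complete_bipartite_edges:
  "{x, y} \<in> edges (complete_bipartite n) \<longleftrightarrow> snd x < n \<and> snd y < n \<and> fst x \<noteq> fst y"
  unfolding complete_bipartite_def
  by (subst edges_graph_of) (auto simp: symp_def mem_Times_iff)

lemma complete_bipartite_vertices: "vertices (complete_bipartite n) = UNIV \<times> {..<n}"
  by (simp add: complete_bipartite_def)

lemma graph_complete_bipartite:
  assumes "n > 0"
  shows "graph (complete_bipartite n)"
  unfolding complete_bipartite_def using assms
  by (intro graph_graph_of) (auto simp: irreflp_def)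

lemma edge_splitting_complete_bipartite: "edge_splitting (complete_bipartite n)"
  by (auto simp: edge_splitting_def complete_bipartite_edges complete_bipartite_vertices)

lemma complete_bipartite_clique:
  assumes "clique K (edges (complete_bipartite n))"
  shows "card K \<le> 2"
proof -
  have "inj_on fst K"
    using assms by (auto simp: clique_def complete_bipartite_edges inj_on_def)
  then show ?thesis
    using card_inj_on_le[of fst K UNIV] by simp
qed

lemma treewidth_complete_bipartite:
  assumes "n > 0"
  shows "n \<le> treewidth (complete_bipartite n) + 1"
proof (rule treewidth_ge_crossing_families
    [OF graph_complete_bipartite[OF assms], of n "\<lambda>i. {(False, i)}" "\<lambda>j. {(True, j)}"])
qed (auto simp: complete_bipartite_vertices complete_bipartite_edges connected_in_iff)

text \<open>A thick grid consists of \<open>n\<close> horizontal tracks (tag \<open>False\<close>) and \<open>n\<close> vertical tracks (tag \<open>True\<close>),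
  each a path on \<open>2 * n\<close> vertices. The vertex \<open>(s, i, m)\<close> is at position \<open>m\<close> of track \<open>i\<close>. Every track
  spends two consecutive positions at each of its crossings with the tracks of the other direction, and
  the four vertices at a crossing are made a clique, a block. The result is the line graph of the
  once subdivided grid with a pendant edge added at both ends of each grid line.\<close>

type_synonym track_vertex = "bool \<times> nat \<times> nat"

fun block :: "track_vertex \<Rightarrow> nat \<times> nat" where
  "block (False, i, m) = (i, m div 2)"
| "block (True, j, m) = (m div 2, j)"

definition track_succ :: "track_vertex \<Rightarrow> track_vertex" where
  "track_succ x = (fst x, fst (snd x), Suc (snd (snd x)))"

definition thick_adj :: "track_vertex \<Rightarrow> track_vertex \<Rightarrow> bool" where
  "thick_adj x y \<longleftrightarrow> x \<noteq> y \<and> (block x = block y \<or> y = track_succ x \<or> x = track_succ y)"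

definition thick_grid :: "nat \<Rightarrow> track_vertex ugraph" where
  "thick_grid n = graph_of (UNIV \<times> {..<n} \<times> {..<2 * n}) thick_adj"

lemma thick_grid_vertices: "vertices (thick_grid n) = UNIV \<times> {..<n} \<times> {..<2 * n}"
  by (simp add: thick_grid_def)

lemma thick_grid_edges:
  "{x, y} \<in> edges (thick_grid n) \<longleftrightarrow>
     x \<in> vertices (thick_grid n) \<and> y \<in> vertices (thick_grid n) \<and> thick_adj x y"
  unfolding thick_grid_def
  by (subst edges_graph_of) (auto simp: symp_def thick_adj_def)

lemma graph_thick_grid:
  assumes "n > 0"
  shows "graph (thick_grid n)"
  unfolding thick_grid_def using assms
  by (intro graph_graph_of) (auto simp: irreflp_def thick_adj_def lessThan_empty_iff)

text \<open>Edges between different blocks. They form a matching, and two blocks are joined by at most one of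
  them; the absence of induced claws and four-cycles rests on these two facts.\<close>

definition link :: "track_vertex \<Rightarrow> track_vertex \<Rightarrow> bool" where
  "link x y \<longleftrightarrow> block x \<noteq> block y \<and> (y = track_succ x \<or> x = track_succ y)"

lemma thick_adj_cases: "thick_adj x y \<Longrightarrow> block x = block y \<or> link x y"
  by (auto simp: thick_adj_def link_def)

lemma link_sym: "link x y \<Longrightarrow> link y x"
  by (auto simp: link_def)

text \<open>A track leaves a block exactly after its odd positions.\<close>

lemma block_track_succ: "block x = block (track_succ x) \<longleftrightarrow> even (snd (snd x))"
  by (cases x rule: block.cases) (auto simp: track_succ_def, presburger+)

lemma link_iff:
  "link x y \<longleftrightarrow> odd (snd (snd x)) \<and> y = track_succ x \<or> odd (snd (snd y)) \<and> x = track_succ y"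
  using block_track_succ[of x] block_track_succ[of y] by (auto simp: link_def)

lemma link_unique:
  assumes "link x y" "link x z"
  shows "y = z"
  using assms unfolding link_iff by (auto simp: track_succ_def prod_eq_iff)

lemma half_Suc_unique:
  fixes m k l :: nat
  assumes "odd m" "m div 2 = k div 2" "l div 2 = Suc (k div 2)"
    and "odd k \<and> l = Suc k \<or> odd l \<and> k = Suc l"
  shows "m = k"
  using assms by (auto elim!: oddE)

text \<open>A link leaving the block of \<open>a\<close> towards the same neighbouring block runs along the same track as the
  link from \<open>a\<close>, since the other three directions lead to other blocks.\<close>

lemma link_blocks_succ:
  assumes "odd (snd (snd a))" "link b c" "block a = block b" "block c = block (track_succ a)"
  shows "a = b"
  using assms unfolding link_iff track_succ_def
  by (cases a rule: block.cases; cases b rule: block.cases; cases c rule: block.cases)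
    (auto intro: half_Suc_unique)

lemma link_blocks:
  assumes "link a d" "link b c" "block a = block b" "block c = block d"
  shows "a = b"
  using assms(1)[unfolded link_iff]
proof
  assume "odd (snd (snd a)) \<and> d = track_succ a"
  then show ?thesis using link_blocks_succ[of a b c] assms by simp
next
  assume "odd (snd (snd d)) \<and> a = track_succ d"
  then have "d = c"
    using link_blocks_succ[of d c b] link_sym[OF assms(2)] assms(3,4) by simp
  then show ?thesis
    using link_unique[of d a b] link_sym[OF assms(1)] link_sym[OF assms(2)] by simp
qed

text \<open>Among three neighbours of \<open>x\<close> at most one is reached by a link, so the other two share the block of
  \<open>x\<close>.\<close>

lemma claw_free_thick_grid: "claw_free (thick_grid n)"
  unfolding claw_free_def
proof (intro ballI impI, elim conjE)
  fix x a b c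
  assume v: "a \<in> vertices (thick_grid n)" "b \<in> vertices (thick_grid n)" "c \<in> vertices (thick_grid n)"
    and e: "{x, a} \<in> edges (thick_grid n)" "{x, b} \<in> edges (thick_grid n)"
      "{x, c} \<in> edges (thick_grid n)"
    and ne: "a \<noteq> b" "a \<noteq> c" "b \<noteq> c"
  have "block x = block a \<or> link x a" "block x = block b \<or> link x b" "block x = block c \<or> link x c"
    using e thick_adj_cases by (auto simp: thick_grid_edges)
  then have "block a = block b \<or> block a = block c \<or> block b = block c"
    using link_unique ne by metis
  then show "{a, b} \<in> edges (thick_grid n) \<or> {a, c} \<in> edges (thick_grid n) \<or>
      {b, c} \<in> edges (thick_grid n)"
    using v ne by (auto simp: thick_grid_edges thick_adj_def)
qed

text \<open>In an induced four-cycle neither two consecutive edges within blocks occur, as their far ends would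
  be adjacent, nor two consecutive links. So block edges and links alternate, and the two links join
  the same pair of blocks.\<close>

lemma square_free_thick_grid: "square_free (thick_grid n)"
  unfolding square_free_def
proof (intro ballI impI, rule ccontr, elim conjE)
  fix a b c d
  assume v: "a \<in> vertices (thick_grid n)" "b \<in> vertices (thick_grid n)"
      "c \<in> vertices (thick_grid n)" "d \<in> vertices (thick_grid n)"
    and e: "{a, b} \<in> edges (thick_grid n)" "{b, c} \<in> edges (thick_grid n)"
      "{c, d} \<in> edges (thick_grid n)" "{d, a} \<in> edges (thick_grid n)"
    and ne: "a \<noteq> c" "b \<noteq> d"
    and no: "\<not> ({a, c} \<in> edges (thick_grid n) \<or> {b, d} \<in> edges (thick_grid n))"
  have adj: "thick_adj a b" "thick_adj b c" "thick_adj c d" "thick_adj d a"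
    using e by (auto simp: thick_grid_edges)
  have nb: "block a \<noteq> block c" "block b \<noteq> block d"
    using no v ne by (auto simp: thick_grid_edges thick_adj_def)
  consider "block a = block b" "link b c" "block c = block d" "link d a"
    | "link a b" "block b = block c" "link c d" "block d = block a"
    using adj[THEN thick_adj_cases] nb ne link_unique link_sym by metis
  then show False
  proof cases
    case 1
    then have "a = b" using link_blocks link_sym by metis
    then show False using adj by (simp add: thick_adj_def)
  next
    case 2
    then have "b = c" using link_blocks link_sym by metis
    then show False using adj by (simp add: thick_adj_def)
  qed
qed

text \<open>Bounded closed neighbourhoods give a cheap bound on cliques. The set \<open>N\<close> consists of the block of \<open>x\<close>
  and the two neighbours of \<open>x\<close> on its track; the bound \<open>6\<close> is not sharp.\<close>

lemma thick_adj_neighbourhood: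
  obtains N where "finite N" "card N \<le> 6" "x \<in> N" "\<And>y. thick_adj x y \<Longrightarrow> y \<in> N"
proof -
  obtain s i m where x: "x = (s, i, m)" by (cases x)
  obtain p q where pq: "block x = (p, q)" by (cases "block x")
  let ?xs = "[(False, p, 2 * q), (False, p, 2 * q + 1), (True, q, 2 * p), (True, q, 2 * p + 1),
    track_succ x, (s, i, m - 1)]"
  have same: "y \<in> set ?xs" if "block y = (p, q)" for y
    using that by (cases y rule: block.cases) auto
  have pred: "y \<in> set ?xs" if "x = track_succ y" for y
    using that x by (cases y) (auto simp: track_succ_def)
  show thesis
  proof (rule that[of "set ?xs"])
    show "card (set ?xs) \<le> 6" using card_length[of ?xs] by simp
    show "x \<in> set ?xs" using same pq by simp
    fix y assume "thick_adj x y"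
    then consider "block y = (p, q)" | "y = track_succ x" | "x = track_succ y"
      using pq by (auto simp: thick_adj_def)
    then show "y \<in> set ?xs"
    proof cases
      case 1
      then show ?thesis by (rule same)
    next
      case 2
      then show ?thesis by simp
    next
      case 3
      then show ?thesis by (rule pred)
    qed
  qed simp
qed

lemma thick_grid_clique:
  assumes "clique K (edges (thick_grid n))"
  shows "card K \<le> 6"
proof (cases "K = {}")
  case False
  then obtain x where x: "x \<in> K" by blast
  obtain N where N: "finite N" "card N \<le> 6" "x \<in> N" "\<And>y. thick_adj x y \<Longrightarrow> y \<in> N"
    by (rule thick_adj_neighbourhood[of x]) (rule that)
  have "y \<in> N" if "y \<in> K" for y
  proof (cases "y = x")
    case False
    then have "{x, y} \<in> edges (thick_grid n)"
      using assms x that by (simp add: clique_def)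
    then show ?thesis using N(4) by (simp add: thick_grid_edges)
  qed (simp add: N(3))
  then have "K \<subseteq> N" by blast
  then have "card K \<le> card N" by (rule card_mono[OF N(1)])
  then show ?thesis using N(2) by linarith
qed simp

lemma connected_in_track:
  assumes "i < n"
  shows "connected_in (thick_grid n) ({s} \<times> {i} \<times> {..<2 * n})"
proof (rule connected_in_root)
  let ?S = "{s} \<times> {i} \<times> {..<2 * n}"
  have "(((s, i, 0) :: track_vertex), (s, i, m)) \<in> (steps (thick_grid n) ?S)\<^sup>*" if "m < 2 * n" for m
    using that
  proof (induction m)
    case (Suc m)
    have "((s, i, m), (s, i, Suc m)) \<in> steps (thick_grid n) ?S"
      using Suc.prems assms
      by (auto simp: steps_def thick_grid_edges thick_adj_def track_succ_def thick_grid_vertices)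
    then show ?case using Suc by (auto intro: rtrancl_into_rtrancl)
  qed simp
  then show "((s, i, 0), u) \<in> (steps (thick_grid n) ?S)\<^sup>*" if "u \<in> ?S" for u
    using that by auto
qed

lemma treewidth_thick_grid:
  assumes "n > 0"
  shows "n \<le> treewidth (thick_grid n) + 1"
proof (rule treewidth_ge_crossing_families[OF graph_thick_grid[OF assms], of n
      "\<lambda>i. {False} \<times> {i} \<times> {..<2 * n}" "\<lambda>j. {True} \<times> {j} \<times> {..<2 * n}"])
  fix i j assume "i < n" "j < n"
  \<comment> \<open>The block \<open>(i, j)\<close> contains a vertex of both tracks.\<close>
  then have "{(False, i, 2 * j), (True, j, 2 * i)} \<in> edges (thick_grid n)"
    by (auto simp: thick_grid_edges thick_adj_def thick_grid_vertices)
  then show "\<exists>x\<in>{False} \<times> {i} \<times> {..<2 * n}. \<exists>y\<in>{True} \<times> {j} \<times> {..<2 * n}.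
      {x, y} \<in> edges (thick_grid n)"
    using \<open>i < n\<close> \<open>j < n\<close> by (intro bexI[of _ "(False, i, 2 * j)"] bexI[of _ "(True, j, 2 * i)"]) auto
qed (auto simp: connected_in_track, auto simp: thick_grid_vertices)

text \<open>The binding function takes only finitely many values on clique numbers up to \<open>c\<close>, while the
  treewidth of the graphs \<open>W n\<close> exceeds every bound. Countability of the vertex type of \<open>W\<close> provides
  copies of these graphs over the type of the class.\<close>

lemma unbounded_if_free_witnesses:
  fixes H :: "'a ugraph" and W :: "nat \<Rightarrow> 'w::countable ugraph"
  assumes H: "graph H"
    and W: "\<And>n. n > 0 \<Longrightarrow> graph (W n)"
    and free: "\<And>n f. n > 0 \<Longrightarrow> \<not> embedding f H (W n)"
    and cl: "\<And>n K. n > 0 \<Longrightarrow> clique K (edges (W n)) \<Longrightarrow> card K \<le> c"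
    and tw: "\<And>n. n > 0 \<Longrightarrow> n \<le> treewidth (W n) + 1"
  shows "\<not> tw_omega_bounded (free_graphs H :: 'v::infinite ugraph set)"
proof
  assume "tw_omega_bounded (free_graphs H :: 'v ugraph set)"
  then obtain b where b: "tw_omega_binding b (free_graphs H :: 'v ugraph set)"
    by (auto simp: tw_omega_bounded_def)
  \<comment> \<open>One more than the bound on treewidth, plus one for the slack in the treewidth hypothesis.\<close>
  define n where "n = Max (b ` {..c}) + 2"
  have n: "n > 0" by (simp add: n_def)
  obtain h0 :: "nat \<Rightarrow> 'v" where "inj h0"
    using infinite_countable_subset[OF infinite_UNIV] by blast
  then have "inj (h0 \<circ> (to_nat :: 'w \<Rightarrow> nat))" by (simp add: inj_compose)
  then obtain h :: "'w \<Rightarrow> 'v" where "inj_on h (vertices (W n))"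
    using inj_on_subset by blast
  note img = graph_image[OF W[OF n] this]
  let ?G = "graph_image h (W n)"
  have "\<not> iso_induced_subgraph H ?G"
  proof
    assume "iso_induced_subgraph H ?G"
    then obtain f where "embedding f H ?G"
      using iso_induced_subgraph_iff_embedding[OF H img(1)] by blast
    then show False using embedding_comp[OF _ img(3)] free[OF n] by blast
  qed
  then have "?G \<in> free_graphs H" using img(1) by (simp add: free_graphs_def)
  moreover have "induced_subgraph ?G ?G"
    using img(1) by (auto simp: induced_subgraph_def graph_def nsets_def)
  ultimately have "treewidth ?G \<le> b (clique_number ?G)"
    using b unfolding tw_omega_binding_def by blast
  also have "clique_number ?G \<le> c"
    using embedding_clique[OF img(3)] cl[OF n] by (intro clique_number_le[OF img(1)]) metis
  then have "b (clique_number ?G) \<le> Max (b ` {..c})" by (intro Max_ge) auto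
  finally have "treewidth (W n) \<le> Max (b ` {..c})"
    using treewidth_mono[OF W[OF n] img(1,2)] by linarith
  then show False using tw[OF n] by (simp add: n_def)
qed

lemma bounded_imp_pattern_free:
  fixes H :: "'a ugraph"
  assumes H: "graph H" and b: "tw_omega_bounded (free_graphs H :: 'v::infinite ugraph set)"
  shows "edge_splitting H" "claw_free H" "square_free H"
proof -
  show "edge_splitting H"
  proof (rule ccontr)
    assume "\<not> edge_splitting H"
    then have "\<not> embedding f H (complete_bipartite n)" for f n
      using edge_splitting_embedding edge_splitting_complete_bipartite by blast
    then have "\<not> tw_omega_bounded (free_graphs H :: 'v ugraph set)"
      using graph_complete_bipartite complete_bipartite_clique treewidth_complete_bipartite
      by (intro unbounded_if_free_witnesses[OF H, where W = complete_bipartite and c = 2])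
    then show False using b by simp
  qed
  have thick: "\<exists>f n. embedding f H (thick_grid n)"
  proof (rule ccontr)
    assume "\<nexists>f n. embedding f H (thick_grid n)"
    then have "\<not> tw_omega_bounded (free_graphs H :: 'v ugraph set)"
      using graph_thick_grid thick_grid_clique treewidth_thick_grid
      by (intro unbounded_if_free_witnesses[OF H, where W = thick_grid and c = 6]) blast+
    then show False using b by simp
  qed
  then show "claw_free H" "square_free H"
    using claw_free_embedding claw_free_thick_grid square_free_embedding square_free_thick_grid
    by blast+
qed

theorem theorem3p1:
  fixes H :: "'a ugraph"
  assumes "graph H"
  shows "(tw_omega_bounded (free_graphs H :: 'v::infinite ugraph set) \<longleftrightarrow>
            iso_induced_subgraph H (path_graph 3) \<or> edgeless H)
       \<and> (iso_induced_subgraph H (path_graph 3) \<longrightarrow>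
            tw_omega_binding (\<lambda>k. k - 1) (free_graphs H :: 'v ugraph set))
       \<and> (edgeless H \<longrightarrow>
            tw_omega_binding (\<lambda>k. ramsey_number (k + 1) (card (vertices H)) - 2)
              (free_graphs H :: 'v ugraph set))"
proof -
  have "iso_induced_subgraph H (path_graph 3) \<or> edgeless H"
    if "tw_omega_bounded (free_graphs H :: 'v ugraph set)"
    using pattern_free_in_path_3[OF assms] bounded_imp_pattern_free[OF assms that] by blast
  then show ?thesis
    using binding_path_3[OF assms] binding_edgeless[OF assms] unfolding tw_omega_bounded_def
    by blast
qed

end
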